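(* Let $\mathbb{T}$ be a time scale with $\sup\mathbb{T}=\infty$ whose graininess function $\mu$ is constant, let $s\in\mathbb{T}$, and let $f:[s,\infty)_{\mathbb{T}}\to\mathbb{C}$ be locally $\Delta$-integrable. Assume that there exists a constant $\alpha\in\mathbb{R}$ with $1+\alpha\mu(t)>0$ for all $t\in[s,\infty)_{\mathbb{T}}$ such that the Laplace transform $\mathcal{L}\{f\}(z)$ exists and $$\mathcal{L}\{f\}(z)=0\quad\text{for all } z\in\mathbb{C}_{\mu_\ast(s)}(\alpha).$$ Then $f$ is a null function on $[s,\infty)_{\mathbb{T}}$, i.e. $\int_s^t f(\eta)\,\Delta\eta=0$ for all $t\in[s,\infty)_{\mathbb{T}}$.
   Context: A time scale $\mathbb{T}$ is a nonempty closed subset of $\mathbb{R}$; $[s,\infty)_{\mathbb{T}}:=[s,\infty)\cap\mathbb{T}$. The forward jump operator is $\sigma(t):=\inf\big((t,\infty)\cap\mathbb{T}\big)$ and the graininess is $\mu(t):=\sigma(t)-t$. The minimal graininess is $\mu_\ast(s):=\inf\{\mu(t):t\in[s,\infty)_{\mathbb{T}}\}$. Integrals are $\Delta$-integrals on $\mathbb{T}$ (Lebesgue $\Delta$-integrals; for an rd-continuous integrand $f$, $\int_s^t f\,\Delta\eta=F(t)-F(s)$ with $F^\Delta=f$). Locally $\Delta$-integrable means $\Delta$-integrable over each compact interval of $[s,\infty)_{\mathbb{T}}$. The improper integral $\int_s^\infty$ is the limit of $\int_s^t$ as $t\to\infty$, $t\in\mathbb{T}$. For $h>0$ let $\mathbb{C}_h:=\{z\in\mathbb{C}:z\neq-1/h\}$,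 and $\mathbb{C}_0:=\mathbb{C}$. The Hilger real part is $\operatorname{Re}_h(z):=\frac1h(|1+hz|-1)$ for $h>0$ and $\operatorname{Re}_0(z):=\operatorname{Re}(z)$. For $h\ge0$ and $\lambda\in\mathbb{R}$, $\mathbb{C}_h(\lambda):=\{z\in\mathbb{C}_h:\operatorname{Re}_h(z)>\lambda\}$. A function $p$ is regressive if it is rd-continuous (continuous at right-dense points, with finite limits at left-dense points) and $1+\mu(t)p(t)\ne0$ for all $t$. For regressive $p$, the exponential $\mathrm{e}_p(\cdot,s)$ is the unique solution of $x^\Delta=p\,x$, $x(s)=1$, and $(\ominus p)(t):=-p(t)/(1+\mu(t)p(t))$. The Laplace transform is $\mathcal{L}\{f\}(z):=\int_s^\infty f(\eta)\,\mathrm{e}_{\ominus z}(\sigma(\eta),s)\,\Delta\eta$ for those $z$ for which the improper integral converges. *)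

theory Defs
  imports "HOL-Analysis.Analysis"
begin

section \<open>Calculus on a time scale\<close>

definition time_scale :: "real set \<Rightarrow> bool" where
  "time_scale T \<longleftrightarrow> closed T \<and> T \<noteq> {}"

text \<open>
  The infimum over the empty set is a junk value in \<open>real\<close>: \<open>forward_jump T t\<close> is meaningful
  only if \<open>t\<close> is not an upper bound of \<open>T\<close>, in particular for every \<open>t\<close> if \<open>T\<close> is unbounded above.
\<close>

definition forward_jump :: "real set \<Rightarrow> real \<Rightarrow> real" where
  "forward_jump T t = Inf ({t<..} \<inter> T)"

definition graininess :: "real set \<Rightarrow> real \<Rightarrow> real" where
  "graininess T t = forward_jump T t - t"

definition min_graininess :: "real set \<Rightarrow> real \<Rightarrow> real" where
  "min_graininess T s = Inf (graininess T ` ({s..} \<inter> T))"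

definition has_delta_derivative ::
    "real set \<Rightarrow> (real \<Rightarrow> complex) \<Rightarrow> complex \<Rightarrow> real \<Rightarrow> bool" where
  "has_delta_derivative T x D t \<longleftrightarrow>
     (\<forall>\<epsilon>>0. \<exists>\<delta>>0. \<forall>r\<in>T. \<bar>r - t\<bar> < \<delta> \<longrightarrow>
        norm (x (forward_jump T t) - x r - D * of_real (forward_jump T t - r))
          \<le> \<epsilon> * \<bar>forward_jump T t - r\<bar>)"

text \<open>
  The Lebesgue \<open>\<Delta>\<close>-measure, a measure on \<open>T\<close>: the completion of the extension of
  \<open>[a,b) \<inter> T \<mapsto> b - a\<close> (for \<open>a, b \<in> T\<close>) to the generated \<open>\<sigma>\<close>-algebra. The lemma
  \<open>emeasure_delta_measure_Ico\<close> below shows that the extension exists; it is unique for \<open>T\<close>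
  unbounded above.
\<close>

definition delta_measure :: "real set \<Rightarrow> real measure" where
  "delta_measure T = completion (extend_measure T {(a, b). a \<in> T \<and> b \<in> T \<and> a \<le> b}
     (\<lambda>(a, b). {a..<b} \<inter> T) (\<lambda>(a, b). ennreal (b - a)))"

text \<open>
  The \<open>\<Delta>\<close>-integral from \<open>a\<close> to \<open>b\<close>, for \<open>a \<le> b\<close>, is taken over \<open>[a,b)\<close>: a right-scattered
  point \<open>t\<close> has mass \<open>graininess T t\<close>, and the mass of \<open>b\<close> is not counted.
\<close>

definition delta_integrable :: "real set \<Rightarrow> real \<Rightarrow> real \<Rightarrow> (real \<Rightarrow> complex) \<Rightarrow> bool" where
  "delta_integrable T a b f \<longleftrightarrow> set_integrable (delta_measure T) ({a..<b} \<inter> T) f"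

definition delta_integral :: "real set \<Rightarrow> real \<Rightarrow> real \<Rightarrow> (real \<Rightarrow> complex) \<Rightarrow> complex" where
  "delta_integral T a b f = set_lebesgue_integral (delta_measure T) ({a..<b} \<inter> T) f"

definition locally_delta_integrable :: "real set \<Rightarrow> real \<Rightarrow> (real \<Rightarrow> complex) \<Rightarrow> bool" where
  "locally_delta_integrable T s f \<longleftrightarrow>
     (\<forall>a\<in>{s..} \<inter> T. \<forall>b\<in>{s..} \<inter> T. a \<le> b \<longrightarrow>
        set_integrable (delta_measure T) ({a..b} \<inter> T) f)"

definition at_top_within :: "real set \<Rightarrow> real filter" where
  "at_top_within T = inf at_top (principal T)"

text \<open>
  \<open>has_delta_derivative\<close> is required at every point of \<open>T\<close>, which is the usual requirement (on
  \<open>T\<close> without a left-scattered maximum) for \<open>T\<close> unbounded above. Solutions are functions on all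
  of \<open>real\<close>, unique only on \<open>T\<close>; hence the description of the value at \<open>t\<close> rather than of the
  function. It is meaningful for regressive \<open>p\<close> and \<open>t \<in> T\<close>.
\<close>

definition delta_exp :: "real set \<Rightarrow> (real \<Rightarrow> complex) \<Rightarrow> real \<Rightarrow> real \<Rightarrow> complex" where
  "delta_exp T p t s =
     (THE y. \<exists>x. x s = 1 \<and> (\<forall>r\<in>T. has_delta_derivative T x (p r * x r) r) \<and> x t = y)"

definition circle_minus :: "real set \<Rightarrow> (real \<Rightarrow> complex) \<Rightarrow> real \<Rightarrow> complex" where
  "circle_minus T p t = - p t / (1 + of_real (graininess T t) * p t)"

definition hilger_plane :: "real \<Rightarrow> complex set" where
  "hilger_plane h = (if h = 0 then UNIV else {z. z \<noteq> - 1 / of_real h})"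

definition hilger_Re :: "real \<Rightarrow> complex \<Rightarrow> real" where
  "hilger_Re h z = (if h = 0 then Re z else (norm (1 + of_real h * z) - 1) / h)"

definition hilger_half_plane :: "real \<Rightarrow> real \<Rightarrow> complex set" where
  "hilger_half_plane h l = {z \<in> hilger_plane h. hilger_Re h z > l}"

definition laplace_integrand ::
    "real set \<Rightarrow> real \<Rightarrow> (real \<Rightarrow> complex) \<Rightarrow> complex \<Rightarrow> real \<Rightarrow> complex" where
  "laplace_integrand T s f z t =
     f t * delta_exp T (circle_minus T (\<lambda>_. z)) (forward_jump T t) s"

definition laplace_exists ::
    "real set \<Rightarrow> real \<Rightarrow> (real \<Rightarrow> complex) \<Rightarrow> complex \<Rightarrow> bool" where
  "laplace_exists T s f z \<longleftrightarrow>
     (\<forall>t\<in>{s..} \<inter> T. delta_integrable T s t (laplace_integrand T s f z)) \<and>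
     (\<exists>L. ((\<lambda>t. delta_integral T s t (laplace_integrand T s f z)) \<longlongrightarrow> L) (at_top_within T))"

definition laplace ::
    "real set \<Rightarrow> real \<Rightarrow> (real \<Rightarrow> complex) \<Rightarrow> complex \<Rightarrow> complex" where
  "laplace T s f z =
     Lim (at_top_within T) (\<lambda>t. delta_integral T s t (laplace_integrand T s f z))"

definition null_function :: "real set \<Rightarrow> real \<Rightarrow> (real \<Rightarrow> complex) \<Rightarrow> bool" where
  "null_function T s f \<longleftrightarrow> (\<forall>t\<in>{s..} \<inter> T. delta_integral T s t f = 0)"

text \<open>
  The extension exists: the image of Lebesgue measure under \<open>x \<mapsto> Sup (T \<inter> {..x})\<close> is one.
\<close>

lemma emeasure_delta_measure_Ico:
  assumes T: "time_scale T" and ab: "a \<in> T" "b \<in> T" "a \<le> b"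
  shows "{a..<b} \<inter> T \<in> sets (delta_measure T)"
    and "emeasure (delta_measure T) ({a..<b} \<inter> T) = ennreal (b - a)"
proof -
  define r where "r x = Sup (T \<inter> {..x})" for x :: real
  define S where "S = {x. \<exists>t\<in>T. t \<le> x}"
  let ?I = "{(a, b). a \<in> T \<and> b \<in> T \<and> a \<le> b}"
  let ?G = "\<lambda>(a, b). {a..<b} \<inter> T"
  define M where "M = extend_measure T ?I ?G (\<lambda>(a, b). ennreal (b - a))"
  define N where "N = distr (restrict_space lborel S) (restrict_space borel T) r"
  have cl: "closed T" using T by (simp add: time_scale_def)
  have r_le: "r x \<le> x" if "x \<in> S" for x
    unfolding r_def using that by (intro cSup_least) (auto simp: S_def)
  have r_in: "r x \<in> T" if "x \<in> S" for x
  proof -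
    have "Sup (T \<inter> {..x}) \<in> T \<inter> {..x}"
      using that cl by (intro closed_contains_Sup) (auto simp: S_def)
    then show ?thesis by (simp add: r_def)
  qed
  have r_ge: "t \<le> r x" if "t \<in> T" "t \<le> x" for t x
    unfolding r_def using that by (intro cSup_upper bdd_aboveI[of _ x]) auto
  have r_mono: "mono_on S r"
    proof (rule mono_onI)
    fix x y assume xy: "x \<in> S" "y \<in> S" "x \<le> y"
    show "r x \<le> r y" using r_in[OF xy(1)] r_le[OF xy(1)] xy(3) by (intro r_ge) auto
  qed
  have S_sets: "S \<in> sets borel"
  proof -
    have "is_interval S"
      unfolding is_interval_1 S_def by (blast intro: order_trans)
    then show ?thesis
      using is_real_interval[of S] by auto
  qed
  have rm: "r \<in> restrict_space lborel S \<rightarrow>\<^sub>M restrict_space borel T"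
  proof (rule measurable_restrict_space2)
    show "r \<in> space (restrict_space lborel S) \<rightarrow> T"
      using r_in by (auto simp: space_restrict_space)
    have "r \<in> borel_measurable (restrict_space borel S)"
      by (rule borel_measurable_mono_on_fnc[OF r_mono])
    then show "r \<in> restrict_space lborel S \<rightarrow>\<^sub>M borel"
      using measurable_cong_sets[of "restrict_space lborel S" "restrict_space borel S" borel borel]
      by (simp add: sets_restrict_space)
  qed
  have G_in: "?G ` ?I \<subseteq> Pow T" by auto
  have Ico_sets: "{c..<d} \<inter> T \<in> sets (restrict_space borel T)" for c d
    using cl by (subst sets_restrict_space_iff) auto
  have G_sets: "?G ` ?I \<subseteq> sets N"
    using Ico_sets by (auto simp: N_def)
  have sets_M: "sets M = sigma_sets T (?G ` ?I)"
    unfolding M_def by (rule sets_extend_measure[OF G_in])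
  have space_N: "space N = T" by (simp add: N_def space_restrict_space)
  have sub: "sets M \<subseteq> sets N"
    unfolding sets_M using sets.sigma_sets_subset[OF G_sets] by (simp add: space_N)
  have N_Ico: "emeasure N ({c..<d} \<inter> T) = ennreal (d - c)" if "c \<in> T" "d \<in> T" "c \<le> d" for c d
  proof -
    have "emeasure N ({c..<d} \<inter> T)
        = emeasure (restrict_space lborel S) (r -` ({c..<d} \<inter> T) \<inter> space (restrict_space lborel S))"
      unfolding N_def by (rule emeasure_distr[OF rm Ico_sets])
    also have "r -` ({c..<d} \<inter> T) \<inter> space (restrict_space lborel S) = {c..<d}"
    proof -
      have "(c \<le> r x \<and> r x < d) \<longleftrightarrow> (c \<le> x \<and> x < d)" if "x \<in> S" for x
        using r_le[OF that] r_ge[of c x] r_ge[of d x] \<open>c \<in> T\<close> \<open>d \<in> T\<close> by linarith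
      moreover have "x \<in> S" if "c \<le> x" for x using that \<open>c \<in> T\<close> by (auto simp: S_def)
      ultimately show ?thesis using r_in by (auto simp: space_restrict_space)
    qed
    also have "emeasure (restrict_space lborel S) {c..<d} = emeasure lborel {c..<d}"
      using S_sets \<open>c \<in> T\<close> by (intro emeasure_restrict_space) (auto simp: S_def)
    finally show ?thesis using that by simp
  qed
  have M_ab: "{a..<b} \<inter> T \<in> sets M" using ab unfolding sets_M by (intro sigma_sets.Basic) blast
  then show "{a..<b} \<inter> T \<in> sets (delta_measure T)"
    unfolding delta_measure_def M_def by (rule sets_completionI_sets)
  have "emeasure M (?G (a, b)) = (\<lambda>(a, b). ennreal (b - a)) (a, b)"
  proof (rule emeasure_extend_measure[OF M_def _ G_in])
    show "positive (sets M) (emeasure N)" by (simp add: positive_def)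
    show "countably_additive (sets M) (emeasure N)"
      using sub emeasure_countably_additive[of N] by (auto simp: countably_additive_def)
  qed (use ab N_Ico in auto)
  then show "emeasure (delta_measure T) ({a..<b} \<inter> T) = ennreal (b - a)"
    using M_ab unfolding delta_measure_def M_def[symmetric] by simp
qed

end

theory Submission
  imports Defs "HOL-Real_Asymp.Real_Asymp"
begin

text \<open>
  Write \<open>h\<close> for the constant graininess. If \<open>h > 0\<close>, then \<open>T\<close> is the lattice \<open>s + h\<nat>\<close> above \<open>s\<close>
  and, with \<open>q = 1 / (1 + h z)\<close>, the transform is \<open>h \<Sum>k. f (s + k h) q^(k+1)\<close>: a power series
  vanishing on a punctured disc, so all its coefficients are zero.

  If \<open>h = 0\<close>, then \<open>T\<close> contains \<open>[s, \<infinity>)\<close> and the \<open>\<Delta>\<close>-measure is Lebesgue measure, so this is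
  Lerch's theorem. For fixed \<open>c > \<alpha>\<close> the function \<open>g t = \<integral>\<^sub>s\<^sup>t f(x) e^(-c(x-s)) dx\<close> is continuous and
  tends to 0. Integration by parts turns the vanishing of the transform at \<open>c + n\<close> into
  \<open>\<integral>\<^sub>s\<^sup>\<infinity> g(u) e^(-n(u-s)) du = 0\<close> for all \<open>n \<ge> 1\<close>; approximating \<open>g\<close> uniformly by polynomials in
  \<open>e^(-(u-s))\<close> gives \<open>\<integral> g(u)^2 e^(-(u-s)) du = 0\<close>, hence \<open>g = 0\<close>.
\<close>

section \<open>Measure and power series preliminaries\<close>

text \<open>Fubini is applied below to \<open>lebesgue\<close> itself, because an absolutely
  integrable function is only Lebesgue measurable. A countable cover that works for
  \<open>lborel\<close> still works, since completion does not change the measure of Borel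
  sets.\<close>

lemma sigma_finite_lebesgue: "sigma_finite_measure (lebesgue :: real measure)"
proof
  obtain A :: "real set set" where "countable A" "A \<subseteq> sets lborel" "\<Union>A = space lborel"
      "\<forall>a\<in>A. emeasure lborel a \<noteq> \<infinity>"
    using lborel.sigma_finite_countable by blast
  then show "\<exists>A. countable A \<and> A \<subseteq> sets (lebesgue :: real measure) \<and> \<Union>A = space lebesgue \<and>
      (\<forall>a\<in>A. emeasure lebesgue a \<noteq> \<infinity>)"
    by (intro exI[of _ A]) auto
qed

text \<open>This lets a completed measure on \<open>T\<close> be recognized as
  \<open>lebesgue_on T\<close>. Since \<open>\<Omega>\<close> is measurable, the null sets of the
  restriction are exactly the null sets of \<open>M\<close> inside \<open>\<Omega>\<close>, so a
  decomposition into a measurable set and a subset of a null set passes between the two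
  sides.\<close>

lemma completion_restrict_space:
  assumes "\<Omega> \<in> sets M"
  shows "completion (restrict_space M \<Omega>) = restrict_space (completion M) \<Omega>"
proof (rule measure_eqI)
  have sub: "\<Omega> \<subseteq> space M" using assms sets.sets_into_space by auto
  have null: "N \<in> null_sets (restrict_space M \<Omega>) \<longleftrightarrow> N \<subseteq> \<Omega> \<and> N \<in> null_sets M" for N
    using assms by (intro null_sets_restrict_space)
  show eq: "sets (completion (restrict_space M \<Omega>)) = sets (restrict_space (completion M) \<Omega>)"
  proof (intro equalityI subsetI)
    fix A assume "A \<in> sets (completion (restrict_space M \<Omega>))"
    then obtain S N N' where *: "A = S \<union> N" "N \<subseteq> N'" "N' \<in> null_sets (restrict_space M \<Omega>)"
        "S \<in> sets (restrict_space M \<Omega>)"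
      by (rule sets_completionE)
    then have "A \<in> sets (completion M)" "A \<subseteq> \<Omega>"
      using assms null sub by (auto simp: sets_restrict_space_iff intro: sets_completionI)
    then show "A \<in> sets (restrict_space (completion M) \<Omega>)"
      using assms sub by (subst sets_restrict_space_iff) (auto simp: Int_absorb2)
  next
    fix A assume "A \<in> sets (restrict_space (completion M) \<Omega>)"
    then have "A \<in> sets (completion M)" and A: "A \<subseteq> \<Omega>"
      using assms sub by (auto simp: sets_restrict_space_iff Int_absorb2)
    then obtain S N N' where *: "A = S \<union> N" "N \<subseteq> N'" "N' \<in> null_sets M" "S \<in> sets M"
      by (auto elim: sets_completionE)
    show "A \<in> sets (completion (restrict_space M \<Omega>))"
    proof (rule sets_completionI)
      show "A = S \<union> N" "N \<subseteq> N' \<inter> \<Omega>" using * A by auto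
      have "N' \<inter> \<Omega> \<in> null_sets M" using * assms by (intro null_set_Int2)
      then show "N' \<inter> \<Omega> \<in> null_sets (restrict_space M \<Omega>)" using null by auto
      show "S \<in> sets (restrict_space M \<Omega>)"
        using * A assms sub by (subst sets_restrict_space_iff) (auto simp: Int_absorb2)
    qed
  qed
  fix A assume A: "A \<in> sets (completion (restrict_space M \<Omega>))"
  have A\<Omega>: "A \<subseteq> \<Omega>" using sets.sets_into_space[OF A] sub by (auto simp: space_restrict_space)
  have "A \<in> sets (completion M)"
    using A A\<Omega> assms sub unfolding eq by (subst (asm) sets_restrict_space_iff) (auto simp: Int_absorb2)
  have main: "main_part (restrict_space M \<Omega>) A \<in> sets (restrict_space M \<Omega>)"
    using A by (rule main_part_sets)
  have mpM: "main_part (restrict_space M \<Omega>) A \<in> sets M" "main_part (restrict_space M \<Omega>) A \<subseteq> \<Omega>"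
    using main assms sub by (auto simp: sets_restrict_space_iff Int_absorb2)
  obtain N where N: "N \<in> null_sets (restrict_space M \<Omega>)" "null_part (restrict_space M \<Omega>) A \<subseteq> N"
    using null_part[OF A] by auto
  have npn: "null_part (restrict_space M \<Omega>) A \<in> null_sets (completion M)"
    using N null null_sets_completion_subset null_sets_completionI by blast
  have "emeasure (completion (restrict_space M \<Omega>)) A = emeasure (restrict_space M \<Omega>) (main_part (restrict_space M \<Omega>) A)"
    using A by (rule emeasure_completion)
  also have "\<dots> = emeasure M (main_part (restrict_space M \<Omega>) A)"
    using mpM assms sub by (subst emeasure_restrict_space) (auto simp: Int_absorb2)
  also have "\<dots> = emeasure (completion M) (main_part (restrict_space M \<Omega>) A)"
    using mpM by simp
  also have "\<dots> = emeasure (completion M) (main_part (restrict_space M \<Omega>) A \<union> null_part (restrict_space M \<Omega>) A)"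
    using mpM npn by (subst emeasure_Un_null_set) auto
  also have "\<dots> = emeasure (completion M) A"
    using A by simp
  also have "\<dots> = emeasure (restrict_space (completion M) \<Omega>) A"
    using A\<Omega> assms sub by (subst emeasure_restrict_space) (auto simp: Int_absorb2)
  finally show "emeasure (completion (restrict_space M \<Omega>)) A = emeasure (restrict_space (completion M) \<Omega>) A" .
qed

text \<open>Letting \<open>x\<close> tend to 0 gives \<open>a 0 = 0\<close>; dividing the series by
  \<open>x\<close> then shifts the coefficients, and induction applies. The point
  \<open>x = 0\<close> is left out of the hypothesis because \<open>1 / (1 + h z)\<close> never
  takes the value 0.\<close>

lemma powser_eq_0_imp_coeffs_eq_0:
  fixes a :: "nat \<Rightarrow> 'a::{real_normed_field,banach}"
  assumes "0 < R" and "\<And>x. x \<noteq> 0 \<Longrightarrow> norm x < R \<Longrightarrow> (\<lambda>n. a n * x ^ n) sums 0"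
  shows "a n = 0"
  using assms(2)
proof (induction n arbitrary: a)
  case 0
  have "((\<lambda>_. 0) \<longlongrightarrow> a 0) (at (0::'a))"
    by (rule powser_limit_0_strong[where f = "\<lambda>_. 0", OF \<open>0 < R\<close> 0])
  then show ?case using LIM_unique tendsto_const by blast
next
  case (Suc n)
  have "((\<lambda>_. 0) \<longlongrightarrow> a 0) (at (0::'a))"
    by (rule powser_limit_0_strong[where f = "\<lambda>_. 0", OF \<open>0 < R\<close> Suc.prems])
  then have a0: "a 0 = 0" using LIM_unique tendsto_const by blast
  have "(\<lambda>n. a (Suc n) * x ^ n) sums 0" if x: "x \<noteq> 0" "norm x < R" for x
  proof -
    have "(\<lambda>n. a (Suc n) * x ^ Suc n) sums 0"
      using Suc.prems[OF x] a0 by (subst sums_Suc_iff) simp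
    then have "(\<lambda>n. a (Suc n) * x ^ Suc n * (1 / x)) sums (0 * (1/x))"
      by (rule sums_mult2)
    then show ?thesis using x by (simp add: field_simps)
  qed
  then show ?case by (rule Suc.IH)
qed

section \<open>Uniqueness for the classical Laplace transform\<close>

lemma absolutely_integrable_mult_continuous:
  fixes f \<phi> :: "real \<Rightarrow> complex"
  assumes f: "f absolutely_integrable_on {a..b}" and \<phi>: "continuous_on {a..b} \<phi>"
  shows "(\<lambda>x. f x * \<phi> x) absolutely_integrable_on {a..b}"
proof -
  have "bounded (\<phi> ` {a..b})" using \<phi> compact_continuous_image compact_imp_bounded by blast
  moreover have "\<phi> \<in> borel_measurable (lebesgue_on {a..b})"
    using \<phi> by (rule continuous_imp_measurable_on_sets_lebesgue) auto
  ultimately have "(\<lambda>x. \<phi> x * f x) absolutely_integrable_on {a..b}"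
    using f by (intro absolutely_integrable_bounded_measurable_product[OF bilinear_times]) auto
  then show ?thesis by (simp add: mult.commute)
qed

lemma integral_mult_by_parts:
  fixes f \<phi> \<phi>' :: "real \<Rightarrow> complex"
  assumes f: "f absolutely_integrable_on {a..b}" and "a \<le> b"
    and \<phi>: "\<And>x. x \<in> {a..b} \<Longrightarrow> (\<phi> has_vector_derivative \<phi>' x) (at x within {a..b})"
    and \<phi>': "continuous_on {a..b} \<phi>'"
  shows "integral {a..b} (\<lambda>x. f x * \<phi> x)
    = integral {a..b} f * \<phi> b - integral {a..b} (\<lambda>u. integral {a..u} f * \<phi>' u)"
proof -
  interpret L: sigma_finite_measure "lebesgue :: real measure" by (rule sigma_finite_lebesgue)
  interpret P: pair_sigma_finite "lebesgue :: real measure" "lebesgue :: real measure" ..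
  obtain K where K: "\<And>x. x \<in> {a..b} \<Longrightarrow> norm (\<phi>' x) \<le> K"
    using compact_imp_bounded[OF compact_continuous_image[OF \<phi>' compact_Icc]]
    unfolding bounded_iff by force
  define f0 where "f0 x = indicator {a..b} x *\<^sub>R f x" for x
  define p0 where "p0 x = indicator {a..b} x *\<^sub>R \<phi>' x" for x
  \<comment> \<open>Integrating \<open>H\<close>, supported on the triangle \<open>x \<le> u\<close>, in both orders gives the claim.\<close>
  define H where "H = (\<lambda>x u. f0 x * p0 u * (if x \<le> u then 1 else 0))"
  have f0: "integrable lebesgue f0" using f unfolding f0_def set_integrable_def .
  have \<phi>'_abs: "\<phi>' absolutely_integrable_on {a..b}"
    using \<phi>' by (rule absolutely_integrable_continuous_real)
  have p0: "integrable lebesgue p0"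
    using \<phi>'_abs unfolding p0_def set_integrable_def .
  note [measurable] = borel_measurable_integrable[OF f0] borel_measurable_integrable[OF p0]
  have idm: "(\<lambda>x::real. x) \<in> borel_measurable lebesgue" by (intro measurable_completion) simp
  \<comment> \<open>With the two projections measurable for the product of the completed measures,
    so is the condition \<open>x \<le> u\<close> in \<open>H\<close>.\<close>
  have [measurable]: "fst \<in> borel_measurable ((lebesgue :: real measure) \<Otimes>\<^sub>M (lebesgue :: real measure))"
    "snd \<in> borel_measurable ((lebesgue :: real measure) \<Otimes>\<^sub>M (lebesgue :: real measure))"
    using measurable_compose[OF measurable_fst idm] measurable_compose[OF measurable_snd idm]
    by this
  have "integrable (lebesgue \<Otimes>\<^sub>M lebesgue) (\<lambda>(x, u). f0 x * p0 u)"
  proof (rule P.Fubini_integrable)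
    show "AE x in lebesgue. integrable lebesgue (\<lambda>y. case (x, y) of (x, u) \<Rightarrow> f0 x * p0 u)"
      using p0 by simp
    show "integrable lebesgue (\<lambda>x. \<integral>y. norm (case (x, y) of (x, u) \<Rightarrow> f0 x * p0 u) \<partial>lebesgue)"
      using f0 by (simp add: norm_mult)
  qed measurable
  then have "integrable (lebesgue \<Otimes>\<^sub>M lebesgue) (case_prod H)"
    by (rule Bochner_Integration.integrable_bound)
       (auto simp: H_def norm_mult intro!: mult_left_le)
  note Fub = P.Fubini_integral[OF this]
  have f_on: "f absolutely_integrable_on {c..d}" if "{c..d} \<subseteq> {a..b}" for c d
    using f that by (rule absolutely_integrable_on_subinterval)
  have 1: "(\<integral>x. H x u \<partial>lebesgue) = indicator {a..b} u *\<^sub>R (integral {a..u} f * \<phi>' u)" for u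
  proof (cases "u \<in> {a..b}")
    case True
    have "(\<integral>x. H x u \<partial>lebesgue) = (\<integral>x. (indicator {a..u} x *\<^sub>R f x) * \<phi>' u \<partial>lebesgue)"
      using True by (intro Bochner_Integration.integral_cong)
        (auto simp: H_def f0_def p0_def indicator_def)
    also have "\<dots> = (LINT x:{a..u}|lebesgue. f x) * \<phi>' u"
      unfolding set_lebesgue_integral_def by (rule integral_mult_left_zero)
    also have "(LINT x:{a..u}|lebesgue. f x) = integral {a..u} f"
      using True by (intro set_lebesgue_integral_eq_integral f_on) auto
    finally show ?thesis using True by simp
  qed (auto simp: H_def p0_def)
  have 2: "(\<integral>u. H x u \<partial>lebesgue) = indicator {a..b} x *\<^sub>R (f x * (\<phi> b - \<phi> x))" for x
  proof (cases "x \<in> {a..b}")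
    case True
    have "(\<integral>u. H x u \<partial>lebesgue) = (\<integral>u. f x * (indicator {x..b} u *\<^sub>R \<phi>' u) \<partial>lebesgue)"
      using True by (intro Bochner_Integration.integral_cong)
        (auto simp: H_def f0_def p0_def indicator_def)
    also have "\<dots> = f x * (LINT u:{x..b}|lebesgue. \<phi>' u)"
      unfolding set_lebesgue_integral_def by (rule integral_mult_right_zero)
    also have "(LINT u:{x..b}|lebesgue. \<phi>' u) = integral {x..b} \<phi>'"
      using True by (intro set_lebesgue_integral_eq_integral
          absolutely_integrable_on_subinterval[OF \<phi>'_abs]) auto
    also have "\<dots> = \<phi> b - \<phi> x"
      using True by (intro integral_unique fundamental_theorem_of_calculus)
        (auto intro: has_vector_derivative_within_subset[OF \<phi>])
    finally show ?thesis using True by simp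
  qed (auto simp: H_def f0_def)
  have \<phi>c: "continuous_on {a..b} \<phi>"
    using \<phi> has_vector_derivative_continuous unfolding continuous_on_eq_continuous_within by blast
  have f\<phi>: "(\<lambda>x. f x * \<phi> x) absolutely_integrable_on {a..b}"
    using f \<phi>c by (rule absolutely_integrable_mult_continuous)
  have f\<phi>b: "(\<lambda>x. f x * \<phi> b) absolutely_integrable_on {a..b}"
    using f by simp
  have fd: "(\<lambda>x. f x * (\<phi> b - \<phi> x)) absolutely_integrable_on {a..b}"
    using set_integral_diff(1)[OF f\<phi>b f\<phi>] by (simp add: right_diff_distrib)
  have gc: "continuous_on {a..b} (\<lambda>u. integral {a..u} f)"
    using f by (intro indefinite_integral_continuous_1) (rule set_lebesgue_integral_eq_integral(1))
  have "(LINT u:{a..b}|lebesgue. integral {a..u} f * \<phi>' u)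
      = (LINT x:{a..b}|lebesgue. f x * (\<phi> b - \<phi> x))"
    using Fub unfolding 1 2 set_lebesgue_integral_def .
  moreover have "(LINT u:{a..b}|lebesgue. integral {a..u} f * \<phi>' u)
      = integral {a..b} (\<lambda>u. integral {a..u} f * \<phi>' u)"
    by (intro set_lebesgue_integral_eq_integral absolutely_integrable_continuous_real
        continuous_intros gc \<phi>')
  moreover have "(LINT x:{a..b}|lebesgue. f x * (\<phi> b - \<phi> x))
      = integral {a..b} (\<lambda>x. f x * \<phi> b - f x * \<phi> x)"
    using set_lebesgue_integral_eq_integral(2)[OF fd] by (simp add: right_diff_distrib)
  moreover have "\<dots> = integral {a..b} f * \<phi> b - integral {a..b} (\<lambda>x. f x * \<phi> x)"
    using set_lebesgue_integral_eq_integral(1)[OF f\<phi>] set_lebesgue_integral_eq_integral(1)[OF f\<phi>b]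
    by (subst Henstock_Kurzweil_Integration.integral_diff) auto
  ultimately show ?thesis by simp
qed

text \<open>The substitution \<open>x = exp (- (u - s))\<close> carries
  \<open>[s, \<infinity>)\<close> to \<open>(0, 1]\<close> and \<open>g\<close> to \<open>G\<close>.
  Decay of \<open>g\<close> at infinity is continuity of \<open>G\<close> at 0, so Weierstrass
  approximation on the compact interval \<open>{0..1}\<close> applies to \<open>G\<close>.\<close>

lemma exp_moments_eq_0_imp_eq_0:
  fixes g :: "real \<Rightarrow> real"
  assumes g: "continuous_on {s..} g" and g0: "(g \<longlongrightarrow> 0) at_top"
    and mom: "\<And>n::nat. n > 0 \<Longrightarrow>
      ((\<lambda>t. integral {s..t} (\<lambda>u. g u * exp (- (real n * (u - s))))) \<longlongrightarrow> 0) at_top"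
    and "t \<ge> s"
  shows "g t = 0"
proof -
  define G where "G x = (if x = 0 then 0 else g (s - ln x))" for x
  have G: "continuous_on {0..1} G"
    unfolding continuous_on_eq_continuous_within
  proof
    fix x :: real assume x: "x \<in> {0..1}"
    show "continuous (at x within {0..1}) G"
    proof (cases "x = 0")
      case True
      have "filterlim (\<lambda>x. s - ln x) at_top (at_right (0::real))"
        using ln_at_0 by (auto simp: filterlim_uminus_at_bot diff_conv_add_uminus
             intro!: filterlim_tendsto_add_at_top[OF tendsto_const] simp del: add_uminus_conv_diff)
      then have "((\<lambda>x. g (s - ln x)) \<longlongrightarrow> 0) (at_right 0)"
        by (rule filterlim_compose[OF g0])
      then have "(G \<longlongrightarrow> 0) (at_right 0)"
        by (rule Lim_transform_eventually)
          (auto simp: G_def eventually_at_filter)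
      then have "(G \<longlongrightarrow> G 0) (at 0 within {0..1})"
        by (auto simp: G_def at_within_Icc_at_right)
      then show ?thesis using True by (simp add: continuous_within)
    next
      case False
      then have x: "0 < x" "x \<le> 1" using x by auto
      have "continuous_on {0<..1} (\<lambda>x. g (s - ln x))"
        by (rule continuous_on_compose2[OF g]) (auto intro!: continuous_intros)
      then have "continuous_on {0<..1} G"
        by (rule continuous_on_eq) (auto simp: G_def)
      then have "continuous (at x within {0<..1}) G" using x by (auto simp: continuous_on_eq_continuous_within)
      moreover have "at x within {0..1} = at x within {0<..1}"
        using x by (intro at_within_nhd[of x "{0<..}"]) auto
      ultimately show ?thesis by (simp add: continuous_within)
    qed
  qed
  have gG: "g u = G (exp (- (u - s)))" for u by (simp add: G_def)
  obtain B where B: "\<And>x. x \<in> {0..1} \<Longrightarrow> \<bar>G x\<bar> \<le> B"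
    using compact_imp_bounded[OF compact_continuous_image[OF G compact_Icc]]
    unfolding bounded_iff by force
  have gB: "\<bar>g u\<bar> \<le> B" if "u \<ge> s" for u unfolding gG using that by (intro B) auto
  have B0: "0 \<le> B" using gB[of s] by linarith
  have int: "h integrable_on {s..t}" if "continuous_on {s..} h" for h :: "real \<Rightarrow> real" and t
    using that by (intro integrable_continuous_real continuous_on_subset[OF that]) auto
  define J where "J t = integral {s..t} (\<lambda>u. (g u)\<^sup>2 * exp (- (u - s)))" for t
  \<comment> \<open>With \<open>p\<close> within \<open>e\<close> of \<open>G\<close>, split
    \<open>g^2 = g * p + g * (g - p)\<close>. The first part contributes \<open>Q\<close>, a
    combination of vanishing moments; the second is at most \<open>e * B\<close> in absolute value,
    and the weight has total mass at most 1.\<close>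
  have J: "J t \<le> e * B" if "t \<ge> s" "e > 0" for t e
  proof -
    obtain p where p: "real_polynomial_function p" "\<And>x. x \<in> {0..1} \<Longrightarrow> \<bar>G x - p x\<bar> < e"
      using Stone_Weierstrass_real_polynomial_function[OF compact_Icc G \<open>e > 0\<close>] by auto
    obtain a n where pa: "p = (\<lambda>x. \<Sum>i\<le>n. a i * x ^ i)"
      using p(1) by (auto simp: real_polynomial_function_iff_sum)
    define Q where "Q t = integral {s..t} (\<lambda>u. g u * p (exp (- (u - s))) * exp (- (u - s)))" for t
    \<comment> \<open>The weight raises every exponent by one, so only the moments of positive order
      \<open>Suc i\<close> occur, for which \<open>mom\<close> is available.\<close>
    have Q_eq: "Q t = (\<Sum>i\<le>n. a i * integral {s..t} (\<lambda>u. g u * exp (- (real (Suc i) * (u - s)))))" for t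
    proof -
      have "Q t = integral {s..t} (\<lambda>u. \<Sum>i\<le>n. a i * (g u * exp (- (real (Suc i) * (u - s)))))"
        unfolding Q_def pa sum_distrib_left sum_distrib_right
        by (intro integral_cong sum.cong refl)
          (simp add: exp_of_nat_mult[symmetric] exp_add[symmetric] algebra_simps)
      also have "\<dots> = (\<Sum>i\<le>n. integral {s..t} (\<lambda>u. a i * (g u * exp (- (real (Suc i) * (u - s))))))"
        by (intro Henstock_Kurzweil_Integration.integral_sum int continuous_intros g) auto
      finally show ?thesis by simp
    qed
    have "(Q \<longlongrightarrow> (\<Sum>i\<le>n. a i * 0)) at_top"
      unfolding Q_eq by (intro tendsto_intros mom) auto
    then have "((\<lambda>t. Q t + e * B) \<longlongrightarrow> 0 + e * B) at_top"
      by (intro tendsto_intros) simp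
    \<comment> \<open>\<open>Q r\<close> is small only for large \<open>r\<close>, so
      \<open>J t\<close> is first enlarged to \<open>J r\<close>; its integrand is
      nonnegative.\<close>
    moreover have "J t \<le> Q r + e * B" if "r \<ge> t" for r
    proof -
      have "J t \<le> J r" unfolding J_def using that \<open>t \<ge> s\<close>
        by (intro integral_subset_le int continuous_intros g) auto
      also have "J r \<le> integral {s..r} (\<lambda>u. g u * p (exp (- (u - s))) * exp (- (u - s)) + e * B * exp (- (u - s)))"
        unfolding J_def
      proof (intro integral_le int continuous_intros g)
        show "continuous_on {s..} (\<lambda>u. p (exp (- (u - s))))"
          unfolding pa by (intro continuous_intros)
        fix u assume u: "u \<in> {s..r}"
        have "g u * (g u - p (exp (- (u - s)))) \<le> \<bar>g u\<bar> * \<bar>g u - p (exp (- (u - s)))\<bar>"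
          by (metis abs_ge_self abs_mult)
        also have "\<dots> \<le> B * e"
          using u p(2)[of "exp (- (u - s))"] gB[of u] gG[of u] B0 by (intro mult_mono) auto
        finally have "(g u)\<^sup>2 \<le> g u * p (exp (- (u - s))) + e * B"
          by (simp add: algebra_simps power2_eq_square)
        then have "(g u)\<^sup>2 * exp (- (u - s)) \<le> (g u * p (exp (- (u - s))) + e * B) * exp (- (u - s))"
          by (rule mult_right_mono) simp
        then show "(g u)\<^sup>2 * exp (- (u - s)) \<le> g u * p (exp (- (u - s))) * exp (- (u - s)) + e * B * exp (- (u - s))"
          by (simp add: distrib_right)
      qed
      also have "\<dots> = Q r + e * B * integral {s..r} (\<lambda>u. exp (- (u - s)))"
        unfolding Q_def
        by (subst Henstock_Kurzweil_Integration.integral_add)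
          (auto simp: pa intro!: int continuous_intros g)
      also have "integral {s..r} (\<lambda>u. exp (- (u - s))) = 1 - exp (- (r - s))"
      proof -
        have "((\<lambda>u. exp (- (u - s))) has_integral (- exp (- (r - s))) - (- exp (- (s - s)))) {s..r}"
          using that \<open>t \<ge> s\<close> by (intro fundamental_theorem_of_calculus)
            (auto intro!: derivative_eq_intros simp flip: has_real_derivative_iff_has_vector_derivative)
        then show ?thesis by (simp add: integral_unique)
      qed
      finally show ?thesis
        using B0 \<open>e > 0\<close> by (smt (verit) exp_gt_zero mult_left_le mult_nonneg_nonneg)
    qed
    then have "\<forall>\<^sub>F r in at_top. J t \<le> Q r + e * B"
      using eventually_ge_at_top by (rule eventually_mono[rotated])
    ultimately show "J t \<le> e * B"
      using tendsto_lowerbound[of "\<lambda>t. Q t + e * B" "0 + e * B" at_top "J t"] by simp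
  qed
  \<comment> \<open>The endpoint \<open>t + 1\<close> keeps the interval nondegenerate when
    \<open>t = s\<close>. Below, the tolerance is divided by \<open>B + 1\<close> because
    \<open>B\<close> may be 0.\<close>
  have J0: "J (t + 1) \<le> 0"
  proof (rule field_le_epsilon)
    fix e :: real assume "e > 0"
    then have "J (t + 1) \<le> e / (B + 1) * B" using B0 \<open>t \<ge> s\<close> by (intro J) auto
    also have "\<dots> \<le> e" using B0 \<open>e > 0\<close> by (simp add: field_simps)
    finally show "J (t + 1) \<le> 0 + e" by simp
  qed
  have hJ: "((\<lambda>u. (g u)\<^sup>2 * exp (- (u - s))) has_integral J (t + 1)) {s..t+1}"
    unfolding J_def by (intro integrable_integral int continuous_intros g)
  have "0 \<le> J (t + 1)" using hJ by (rule has_integral_nonneg) auto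
  with J0 hJ have "((\<lambda>u. (g u)\<^sup>2 * exp (- (u - s))) has_integral 0) (cbox s (t+1))" by simp
  then have "(g t)\<^sup>2 * exp (- (t - s)) = 0"
    using \<open>t \<ge> s\<close>
    by (intro has_integral_0_cbox_imp_0[where f = "\<lambda>u. (g u)\<^sup>2 * exp (- (u - s))" and a = s and b = "t+1"])
      (auto intro!: continuous_intros continuous_on_subset[OF g])
  then show ?thesis by simp
qed


text \<open>The sign of \<open>c\<close> is left free: \<open>c = n\<close> produces the exponential
  moments of a primitive, and a second use with the opposite rate removes a damping factor
  again.\<close>

lemma integral_mult_exp_by_parts:
  fixes f :: "real \<Rightarrow> complex"
  assumes f: "f absolutely_integrable_on {s..t}" and "s \<le> t"
  shows "integral {s..t} (\<lambda>x. f x * of_real (exp (- (c * (x - s)))))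
    = integral {s..t} f * of_real (exp (- (c * (t - s))))
      + of_real c * integral {s..t} (\<lambda>u. integral {s..u} f * of_real (exp (- (c * (u - s)))))"
proof -
  have "integral {s..t} (\<lambda>x. f x * of_real (exp (- (c * (x - s)))))
    = integral {s..t} f * of_real (exp (- (c * (t - s))))
      - integral {s..t} (\<lambda>u. integral {s..u} f * of_real (- c * exp (- (c * (u - s)))))"
  proof (rule integral_mult_by_parts[OF assms])
    fix x :: real
    have "((\<lambda>x. exp (- (c * (x - s)))) has_vector_derivative - c * exp (- (c * (x - s)))) (at x within {s..t})"
      unfolding has_real_derivative_iff_has_vector_derivative[symmetric]
      by (auto intro!: derivative_eq_intros)
    then show "((\<lambda>x. complex_of_real (exp (- (c * (x - s))))) has_vector_derivative
        of_real (- c * exp (- (c * (x - s))))) (at x within {s..t})"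
      by (rule bounded_linear.has_vector_derivative[OF bounded_linear_of_real])
  qed (intro continuous_intros)
  moreover have "integral {s..t} (\<lambda>u. integral {s..u} f * of_real (- c * exp (- (c * (u - s)))))
     = integral {s..t} (\<lambda>u. of_real (- c) * (integral {s..u} f * of_real (exp (- (c * (u - s))))))"
    by (intro integral_cong) (simp add: mult_ac)
  ultimately show ?thesis by simp
qed

text \<open>The running integral of \<open>f\<close> itself may grow, so \<open>f\<close> is damped
  to \<open>f0\<close>, whose primitive \<open>g\<close> tends to the transform at \<open>c\<close>,
  that is, to 0. Only the real arguments \<open>c + n\<close> enter the argument.\<close>

lemma laplace_eq_0_imp_integral_eq_0:
  fixes f :: "real \<Rightarrow> complex"
  assumes f: "\<And>t. f absolutely_integrable_on {s..t}"
    and lap: "\<And>c. c > \<alpha> \<Longrightarrow>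
      ((\<lambda>t. integral {s..t} (\<lambda>x. f x * of_real (exp (- (c * (x - s)))))) \<longlongrightarrow> 0) at_top"
    and "t \<ge> s"
  shows "integral {s..t} f = 0"
proof -
  define c where "c = \<alpha> + 1"
  define f0 where "f0 x = f x * of_real (exp (- (c * (x - s))))" for x
  define g where "g t = integral {s..t} f0" for t
  have f0: "f0 absolutely_integrable_on {s..t}" for t
    unfolding f0_def by (intro absolutely_integrable_mult_continuous f continuous_intros)
  have g_Icc: "continuous_on {s..t} g" for t
    unfolding g_def
    by (intro indefinite_integral_continuous_1 set_lebesgue_integral_eq_integral(1) f0)
  have g_cont: "continuous_on {s..} g"
    unfolding continuous_on_eq_continuous_within
  proof
    fix x assume x: "x \<in> {s..}"
    have "continuous (at x within {s..x+1}) g"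
      using g_Icc[of "x+1"] x by (auto simp: continuous_on_eq_continuous_within)
    moreover have "at x within {s..} = at x within {s..x+1}"
      by (intro at_within_nhd[of x "{..<x+1}"]) auto
    ultimately show "continuous (at x within {s..}) g" by (simp add: continuous_within)
  qed
  have g0: "(g \<longlongrightarrow> 0) at_top"
    using lap[of c] unfolding g_def f0_def c_def by simp
  \<comment> \<open>By parts, the integral of \<open>f0 * ?E\<close> is the boundary term
    \<open>g t * ?E t\<close> plus \<open>n\<close> times the moment. The integral tends to the
    transform at \<open>c + n\<close>, which is 0, and the boundary term tends to 0 as well.\<close>
  have mom: "((\<lambda>t. integral {s..t} (\<lambda>u. g u * of_real (exp (- (real n * (u - s)))))) \<longlongrightarrow> 0) at_top"
    if "n > 0" for n
  proof -
    let ?E = "\<lambda>u. complex_of_real (exp (- (real n * (u - s))))"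
    have 1: "((\<lambda>t. integral {s..t} (\<lambda>x. f0 x * ?E x)) \<longlongrightarrow> 0) at_top"
    proof -
      have "f0 x * ?E x = f x * of_real (exp (- ((c + real n) * (x - s))))" for x
        by (simp add: f0_def mult.assoc flip: of_real_mult exp_add) (simp add: algebra_simps)
      then show ?thesis using lap[of "c + real n"] by (simp add: c_def)
    qed
    have "((\<lambda>t. exp (- (real n * (t - s)))) \<longlongrightarrow> 0) at_top"
      using that by real_asymp
    then have 2: "((\<lambda>t. g t * ?E t) \<longlongrightarrow> 0 * of_real 0) at_top"
      by (intro tendsto_intros g0)
    have "((\<lambda>t. (integral {s..t} (\<lambda>x. f0 x * ?E x) - g t * ?E t) / of_nat n) \<longlongrightarrow> (0 - 0 * of_real 0) / of_nat n) at_top"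
      using that by (intro tendsto_intros 1 2) auto
    moreover have "\<forall>\<^sub>F t in at_top. (integral {s..t} (\<lambda>x. f0 x * ?E x) - g t * ?E t) / of_nat n
        = integral {s..t} (\<lambda>u. g u * ?E u)"
      using eventually_ge_at_top[of s]
    proof eventually_elim
      case (elim t)
      show ?case
        using integral_mult_exp_by_parts[OF f0 elim, of "real n"] that
        unfolding g_def[symmetric] by (simp add: field_simps)
    qed
    ultimately show ?thesis by (simp add: Lim_transform_eventually)
  qed
  have int: "(\<lambda>u. g u * of_real (exp (- (real n * (u - s))))) integrable_on {s..t}" for n t
    by (intro integrable_continuous_real continuous_intros g_Icc)
  \<comment> \<open>The kernel is real, so the moments of \<open>Re (g t)\<close> and
    \<open>Im (g t)\<close> vanish separately.\<close>
  have Re0: "Re (g t) = 0" if "t \<ge> s" for t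
  proof (rule exp_moments_eq_0_imp_eq_0[where g = "\<lambda>t. Re (g t)", OF _ _ _ that])
    fix n :: nat assume "n > 0"
    have "integral {s..t} (\<lambda>u. Re (g u) * exp (- (real n * (u - s))))
       = Re (integral {s..t} (\<lambda>u. g u * of_real (exp (- (real n * (u - s))))))" for t
      using integral_linear[OF int bounded_linear_Re] by (simp add: o_def)
    then show "((\<lambda>t. integral {s..t} (\<lambda>u. Re (g u) * exp (- (real n * (u - s))))) \<longlongrightarrow> 0) at_top"
      using tendsto_Re[OF mom[OF \<open>n > 0\<close>]] by simp
  qed (use g_cont tendsto_Re[OF g0] in \<open>auto intro: continuous_intros\<close>)
  have Im0: "Im (g t) = 0" if "t \<ge> s" for t
  proof (rule exp_moments_eq_0_imp_eq_0[where g = "\<lambda>t. Im (g t)", OF _ _ _ that])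
    fix n :: nat assume "n > 0"
    have "integral {s..t} (\<lambda>u. Im (g u) * exp (- (real n * (u - s))))
       = Im (integral {s..t} (\<lambda>u. g u * of_real (exp (- (real n * (u - s))))))" for t
      using integral_linear[OF int bounded_linear_Im] by (simp add: o_def)
    then show "((\<lambda>t. integral {s..t} (\<lambda>u. Im (g u) * exp (- (real n * (u - s))))) \<longlongrightarrow> 0) at_top"
      using tendsto_Im[OF mom[OF \<open>n > 0\<close>]] by simp
  qed (use g_cont tendsto_Im[OF g0] in \<open>auto intro: continuous_intros\<close>)
  have g_eq_0: "g t = 0" if "t \<ge> s" for t
    using Re0[OF that] Im0[OF that] by (simp add: complex_eq_iff)
  \<comment> \<open>The damping is undone by integrating by parts with rate \<open>- c\<close>:
    every resulting term contains \<open>g\<close>, which is 0 on \<open>{s..}\<close>.\<close>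
  have "f x = f0 x * of_real (exp (- (- c * (x - s))))" for x
    by (simp add: f0_def mult.assoc flip: of_real_mult exp_add)
  then have "integral {s..t} f = integral {s..t} (\<lambda>x. f0 x * of_real (exp (- (- c * (x - s)))))"
    by presburger
  also have "\<dots> = 0"
  proof -
    have "integral {s..t} (\<lambda>u. g u * of_real (exp (- (- c * (u - s))))) = integral {s..t} (\<lambda>u. 0)"
      by (intro integral_cong) (simp add: g_eq_0)
    then show ?thesis
      unfolding integral_mult_exp_by_parts[OF f0 \<open>t \<ge> s\<close>] g_def[symmetric] g_eq_0[OF \<open>t \<ge> s\<close>]
      by simp
  qed
  finally show ?thesis .
qed

section \<open>Time scales with constant graininess\<close>

locale unbounded_time_scale =
  fixes T :: "real set"
  assumes time_scale: "time_scale T" and unbounded: "\<not> bdd_above T"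
begin

lemma closed: "closed T" and nonempty: "T \<noteq> {}"
  using time_scale by (auto simp: time_scale_def)

lemma ex_gt: "\<exists>u\<in>T. t < u"
  using unbounded by (auto simp: bdd_above_def not_le)

text \<open>Limits along a nontrivial filter are unique; this ties the \<open>Lim\<close> in
  \<open>laplace\<close> to the convergence in \<open>laplace_exists\<close>.\<close>

lemma at_top_within_neq_bot: "at_top_within T \<noteq> bot"
proof
  assume "at_top_within T = bot"
  then have "\<forall>\<^sub>F t in at_top_within T. False" by (simp add: eventually_bot)
  then obtain N where "\<And>t. t \<ge> N \<Longrightarrow> t \<notin> T"
    by (auto simp: at_top_within_def eventually_inf_principal eventually_at_top_linorder)
  then show False using ex_gt[of N] less_imp_le by blast
qed

lemma forward_jump_in: "forward_jump T t \<in> T" and forward_jump_ge: "t \<le> forward_jump T t"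
proof -
  \<comment> \<open>Unboundedness excludes the junk value of \<open>Inf\<close> at the empty
    set.\<close>
  have ne: "{t<..} \<inter> T \<noteq> {}" using ex_gt by auto
  have "forward_jump T t \<in> closure ({t<..} \<inter> T)"
    unfolding forward_jump_def using ne by (intro closure_contains_Inf bdd_belowI[of _ t]) auto
  also have "\<dots> \<subseteq> T" using closed by (intro closure_minimal) auto
  finally show "forward_jump T t \<in> T" .
  show "t \<le> forward_jump T t"
    unfolding forward_jump_def using ne by (intro cInf_greatest) auto
qed

lemma forward_jump_le: "u \<in> T \<Longrightarrow> t < u \<Longrightarrow> forward_jump T t \<le> u"
  unfolding forward_jump_def by (intro cInf_lower bdd_belowI[of _ t]) auto

lemma laplace_tendsto:
  assumes "laplace_exists T s f z"
  shows "((\<lambda>t. delta_integral T s t (laplace_integrand T s f z)) \<longlongrightarrow> laplace T s f z)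
    (at_top_within T)"
proof -
  obtain L where L: "((\<lambda>t. delta_integral T s t (laplace_integrand T s f z)) \<longlongrightarrow> L) (at_top_within T)"
    using assms unfolding laplace_exists_def by blast
  then show ?thesis
    unfolding laplace_def by (simp add: tendsto_Lim[OF at_top_within_neq_bot L])
qed

end

locale constant_graininess = unbounded_time_scale +
  fixes h :: real
  assumes graininess: "\<And>t. t \<in> T \<Longrightarrow> graininess T t = h"
begin

lemma forward_jump_eq: "t \<in> T \<Longrightarrow> forward_jump T t = t + h"
  using graininess by (simp add: graininess_def algebra_simps)

lemma circle_minus_const: "t \<in> T \<Longrightarrow> circle_minus T (\<lambda>_. z) t = - z / (1 + of_real h * z)"
  by (simp add: circle_minus_def graininess)

lemma min_graininess_eq: "s \<in> T \<Longrightarrow> min_graininess T s = h"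
proof -
  assume "s \<in> T"
  then have "graininess T ` ({s..} \<inter> T) = {h}" using graininess by auto
  then show ?thesis by (simp add: min_graininess_def)
qed

end

section \<open>Positive graininess: lattices and power series\<close>

locale discrete_time_scale = constant_graininess +
  assumes h_pos: "h > 0"
begin

lemma shift_in: "t \<in> T \<Longrightarrow> t + real n * h \<in> T"
proof (induction n)
  case (Suc n)
  then show ?case
    using forward_jump_in[of "t + real n * h"] forward_jump_eq[of "t + real n * h"]
    by (simp add: algebra_simps)
qed simp

text \<open>Take the largest \<open>n\<close> with \<open>t + n h \<le> u\<close>. If the inequality
  were strict, the forward jump \<open>t + (n + 1) h\<close> would still be at most
  \<open>u\<close>, against the choice of \<open>n\<close>.\<close>

lemma ex_shift:
  assumes "t \<in> T" "u \<in> T" "t \<le> u"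
  shows "\<exists>n. u = t + real n * h"
proof -
  define n where "n = nat \<lfloor>(u - t) / h\<rfloor>"
  have "real n \<le> (u - t) / h" "(u - t) / h < real n + 1"
    using assms h_pos unfolding n_def by (auto simp: divide_nonneg_pos)
  then have n: "real n * h \<le> u - t" "u - t < real n * h + h"
    using h_pos by (simp_all add: field_simps)
  have "\<not> t + real n * h < u"
    using forward_jump_le[of u "t + real n * h"] forward_jump_eq[OF shift_in[OF assms(1)], of n] n assms
    by auto
  with n show ?thesis by (intro exI[of _ n]) simp
qed

lemma isolated:
  assumes "t \<in> T" "u \<in> T" "\<bar>u - t\<bar> < h"
  shows "u = t"
proof -
  have "u = t" if tu: "t \<in> T" "u \<in> T" "\<bar>u - t\<bar> < h" "t \<le> u" for t u
  proof -
    obtain n where n: "u = t + real n * h" using ex_shift tu by blast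
    then have "real n * h < 1 * h" using tu by simp
    then have "real n < 1" using h_pos by simp
    with n show ?thesis by simp
  qed
  then show ?thesis using assms by (metis abs_minus_commute linear)
qed

text \<open>Within distance \<open>h\<close> of \<open>t\<close> the only point of \<open>T\<close>
  is \<open>t\<close>, so the definition tests \<open>r = t\<close> alone, and arbitrary
  \<open>\<epsilon>\<close> forces equality.\<close>

lemma has_delta_derivative_iff:
  assumes t: "t \<in> T"
  shows "has_delta_derivative T x D t \<longleftrightarrow> x (t + h) - x t = D * of_real h"
proof
  assume D: "has_delta_derivative T x D t"
  have le: "norm (x (t + h) - x t - D * of_real h) \<le> e" if "e > 0" for e
  proof -
    have "e / h > 0" using \<open>e > 0\<close> h_pos by simp
    then have "\<exists>d>0. \<forall>r\<in>T. \<bar>r - t\<bar> < d \<longrightarrow>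
        norm (x (t + h) - x r - D * of_real (t + h - r)) \<le> e / h * \<bar>t + h - r\<bar>"
      using D unfolding has_delta_derivative_def forward_jump_eq[OF t] by blast
    then have "norm (x (t + h) - x t - D * of_real (t + h - t)) \<le> e / h * \<bar>t + h - t\<bar>"
      using t by auto
    then show ?thesis using h_pos by simp
  qed
  have "norm (x (t + h) - x t - D * of_real h) \<le> 0"
    by (rule field_le_epsilon) (simp add: le)
  then show "x (t + h) - x t = D * of_real h" by simp
next
  assume D: "x (t + h) - x t = D * of_real h"
  show "has_delta_derivative T x D t"
    unfolding has_delta_derivative_def forward_jump_eq[OF t]
  proof (intro allI impI exI[of _ h] conjI ballI)
    fix e r :: real assume "e > 0" "r \<in> T" "\<bar>r - t\<bar> < h"
    then show "norm (x (t + h) - x r - D * of_real (t + h - r)) \<le> e * \<bar>t + h - r\<bar>"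
      using isolated[OF t, of r] D by simp
  qed (rule h_pos)
qed

text \<open>With \<open>w = 1 + h z\<close>, the identity
  \<open>1 + h * (circle_minus z) = 1 / w\<close> turns the dynamic equation into the recursion
  \<open>x (t + h) = x t / w\<close>.\<close>

lemma delta_exp_circle_minus:
  assumes s: "s \<in> T" and z: "1 + of_real h * z \<noteq> 0"
  shows "delta_exp T (circle_minus T (\<lambda>_. z)) (s + real n * h) s = inverse (1 + of_real h * z) ^ n"
proof -
  define w where "w = 1 + of_real h * z"
  have w: "w \<noteq> 0" using z by (simp add: w_def)
  have solution: "has_delta_derivative T x (circle_minus T (\<lambda>_. z) t * x t) t \<longleftrightarrow> x (t + h) = x t * inverse w"
    if "t \<in> T" for x t
  proof -
    have "circle_minus T (\<lambda>_. z) t * x t * of_real h = (inverse w - 1) * x t"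
      using w that by (simp add: circle_minus_const flip: w_def) (simp add: w_def field_simps)
    then show ?thesis by (auto simp: has_delta_derivative_iff[OF that] algebra_simps)
  qed
  show ?thesis
    unfolding delta_exp_def w_def[symmetric]
  proof (rule the_equality)
    \<comment> \<open>A solution must obey the equation at points of \<open>T\<close> below
      \<open>s\<close> too; a complex power through \<open>Ln w\<close> covers every real
      \<open>t\<close> at once.\<close>
    define x where "x t = exp (- of_real ((t - s) / h) * Ln w)" for t
    have "x (t + h) = x t * inverse w" for t
    proof -
      have "(t + h - s) / h = (t - s) / h + 1" using h_pos by (simp add: field_simps)
      moreover have "- (c + 1) * Ln w = - c * Ln w - Ln w" for c
        by (simp add: algebra_simps)
      ultimately have "x (t + h) = exp (- of_real ((t - s) / h) * Ln w - Ln w)"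
        by (simp only: x_def of_real_add of_real_1)
      also have "\<dots> = x t * inverse w"
        using w by (simp add: exp_diff x_def divide_inverse)
      finally show ?thesis .
    qed
    moreover have "x (s + real n * h) = inverse w ^ n"
    proof -
      have "x (s + real n * h) = exp (of_nat n * (- Ln w))"
        unfolding x_def using h_pos by simp
      also have "\<dots> = inverse w ^ n"
        using w by (simp only: exp_of_nat_mult exp_minus exp_Ln not_False_eq_True)
      finally show ?thesis .
    qed
    moreover have "x s = 1" by (simp add: x_def)
    ultimately show "\<exists>x. x s = 1 \<and>
        (\<forall>r\<in>T. has_delta_derivative T x (circle_minus T (\<lambda>_. z) r * x r) r) \<and>
        x (s + real n * h) = inverse w ^ n"
      using solution by blast
  next
    fix y
    assume "\<exists>x. x s = 1 \<and>
        (\<forall>r\<in>T. has_delta_derivative T x (circle_minus T (\<lambda>_. z) r * x r) r) \<and>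
        x (s + real n * h) = y"
    then obtain x where x: "x s = 1" "\<And>t. t \<in> T \<Longrightarrow> x (t + h) = x t * inverse w"
        "x (s + real n * h) = y"
      using solution by blast
    have "x (s + real n * h) = inverse w ^ n"
    proof (induction n)
      case (Suc n)
      then show ?case
        using x(2)[OF shift_in[OF s], of n] by (simp add: algebra_simps)
    qed (simp add: x)
    with x show "y = inverse w ^ n" by simp
  qed
qed

text \<open>On \<open>[s, s + n h)\<close> the time scale has only \<open>n\<close> points, so the
  restricted integrand is a finite combination of indicators of singletons.\<close>

lemma delta_integral_eq_sum:
  assumes s: "s \<in> T"
  shows "delta_integral T s (s + real n * h) F = (\<Sum>k<n. of_real h * F (s + real k * h))"
proof -
  let ?p = "\<lambda>k. s + real k * h"
  have set_eq: "{s..<?p n} \<inter> T = ?p ` {..<n}"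
  proof (intro equalityI subsetI)
    fix t assume t: "t \<in> {s..<?p n} \<inter> T"
    then obtain k where "t = ?p k" using ex_shift[OF s, of t] by auto
    then show "t \<in> ?p ` {..<n}" using t h_pos by auto
  qed (use s shift_in h_pos in auto)
  \<comment> \<open>Thus a singleton is a generator of the measure, with mass
    \<open>(t + h) - t = h\<close>.\<close>
  have Ico: "{t..<t + h} \<inter> T = {t}" if "t \<in> T" for t
    using isolated[OF that] that h_pos by fastforce
  have singleton: "{t} \<in> sets (delta_measure T)" "measure (delta_measure T) {t} = h"
      "emeasure (delta_measure T) {t} < \<infinity>" if "t \<in> T" for t
    using emeasure_delta_measure_Ico[OF time_scale that, of "t + h"] shift_in[OF that, of 1] h_pos
    unfolding Ico[OF that] by (simp_all add: measure_def)
  have inj: "inj_on ?p {..<n}" using h_pos by (auto simp: inj_on_def)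
  have "has_bochner_integral (delta_measure T)
      (\<lambda>t. \<Sum>k<n. indicator {?p k} t *\<^sub>R F (?p k)) (\<Sum>k<n. measure (delta_measure T) {?p k} *\<^sub>R F (?p k))"
    using singleton shift_in[OF s]
    by (intro has_bochner_integral_sum has_bochner_integral_scaleR_left has_bochner_integral_real_indicator) auto
  moreover have "(\<lambda>t. \<Sum>k<n. indicator {?p k} t *\<^sub>R F (?p k)) = (\<lambda>t. indicator ({s..<?p n} \<inter> T) t *\<^sub>R F t)"
  proof
    fix t
    have "(\<Sum>k<n. indicator {?p k} t *\<^sub>R F (?p k)) = (\<Sum>u\<in>?p ` {..<n}. indicator {u} t *\<^sub>R F u)"
      by (simp only: sum.reindex[OF inj] o_def)
    also have "\<dots> = (\<Sum>u\<in>?p ` {..<n}. if u = t then F t else 0)"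
      by (intro sum.cong) (auto simp: indicator_def)
    also have "\<dots> = indicator (?p ` {..<n}) t *\<^sub>R F t"
      by (subst sum.delta) (auto simp: indicator_def)
    finally show "(\<Sum>k<n. indicator {?p k} t *\<^sub>R F (?p k)) = indicator ({s..<?p n} \<inter> T) t *\<^sub>R F t"
      unfolding set_eq .
  qed
  ultimately show ?thesis
    unfolding delta_integral_def set_lebesgue_integral_def
    using singleton(2)[OF shift_in[OF s]]
    by (simp add: has_bochner_integral_integral_eq scaleR_conv_of_real)
qed

text \<open>Evaluating the improper integral along the lattice turns its convergence into that of a
  series.\<close>

lemma filterlim_shift:
  assumes s: "s \<in> T"
  shows "filterlim (\<lambda>n. s + real n * h) (at_top_within T) sequentially"
proof -
  have "filterlim (\<lambda>n. s + real n * h) at_top sequentially"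
    using h_pos by real_asymp
  then show ?thesis
    unfolding at_top_within_def using shift_in[OF s] by (simp add: filterlim_inf filterlim_principal)
qed

lemma null_function_if_laplace_eq_0:
  assumes s: "s \<in> T" and \<alpha>: "1 + \<alpha> * h > 0"
    and lap: "\<And>z. z \<in> hilger_half_plane h \<alpha> \<Longrightarrow> laplace_exists T s f z \<and> laplace T s f z = 0"
  shows "null_function T s f"
proof -
  define a where "a k = f (s + real k * h)" for k :: nat
  \<comment> \<open>The radius comes from the Hilger half plane:
    \<open>hilger_Re h z > \<alpha>\<close> means \<open>norm (1 + h z) > 1 + \<alpha> h\<close>,
    and \<open>z\<close> is chosen below so that \<open>1 + h z = 1 / q\<close>.\<close>
  have "(\<lambda>k. a k * q ^ k) sums 0" if q: "q \<noteq> 0" "norm q < 1 / (1 + \<alpha> * h)" for q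
  proof -
    define z where "z = (1 / q - 1) / of_real h"
    have wz: "1 + of_real h * z = 1 / q" using h_pos by (simp add: z_def)
    then have wz0: "1 + of_real h * z \<noteq> 0" using q by simp
    have "z \<noteq> - 1 / of_real h" using wz0 h_pos by (auto simp: field_simps)
    moreover have "(norm (1 + of_real h * z) - 1) / h > \<alpha>"
      using q \<alpha> h_pos unfolding wz by (simp add: norm_divide field_simps)
    ultimately have "z \<in> hilger_half_plane h \<alpha>"
      using h_pos by (simp add: hilger_half_plane_def hilger_plane_def hilger_Re_def)
    from laplace_tendsto[of s f z] lap[OF this]
    have "((\<lambda>t. delta_integral T s t (laplace_integrand T s f z)) \<longlongrightarrow> 0) (at_top_within T)"
      by simp
    then have "(\<lambda>n. delta_integral T s (s + real n * h) (laplace_integrand T s f z)) \<longlonglongrightarrow> 0"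
      by (rule filterlim_compose[OF _ filterlim_shift[OF s]])
    \<comment> \<open>The exponent is \<open>Suc k\<close> because the exponential is evaluated at
      the forward jump; dividing by \<open>h * q\<close> afterwards removes the extra
      factor.\<close>
    moreover have "laplace_integrand T s f z (s + real k * h) = a k * q ^ Suc k" for k
    proof -
      have "forward_jump T (s + real k * h) = s + real (Suc k) * h"
        using forward_jump_eq[OF shift_in[OF s], of k] by (simp add: algebra_simps)
      then show ?thesis
        by (simp only: laplace_integrand_def a_def delta_exp_circle_minus[OF s wz0] wz) simp
    qed
    ultimately have "(\<lambda>k. of_real h * (a k * q ^ Suc k)) sums 0"
      unfolding sums_def delta_integral_eq_sum[OF s] by simp
    then have "(\<lambda>k. 1 / (of_real h * q) * (of_real h * (a k * q ^ Suc k))) sums (1 / (of_real h * q) * 0)"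
      by (rule sums_mult)
    then show ?thesis using q h_pos by simp
  qed
  then have a: "a k = 0" for k
    using \<alpha> by (intro powser_eq_0_imp_coeffs_eq_0[of "1 / (1 + \<alpha> * h)" a]) auto
  show ?thesis
    unfolding null_function_def
  proof
    fix t assume "t \<in> {s..} \<inter> T"
    then obtain n where "t = s + real n * h" using ex_shift[OF s] by auto
    then show "delta_integral T s t f = 0"
      using a by (simp add: delta_integral_eq_sum[OF s] a_def)
  qed
qed

end

section \<open>Zero graininess: a closed ray or the whole line with Lebesgue measure\<close>

locale continuous_time_scale = constant_graininess T 0 for T
begin

text \<open>If \<open>u\<close> were missing, the last point \<open>a\<close> of \<open>T\<close>
  before \<open>u\<close> would be its own forward jump, so \<open>T\<close> would have points
  strictly between \<open>a\<close> and \<open>u\<close>.\<close>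

lemma upward_closed:
  assumes "t \<in> T" "t \<le> u"
  shows "u \<in> T"
proof (rule ccontr)
  assume u: "u \<notin> T"
  define a where "a = Sup (T \<inter> {..u})"
  have "a \<in> T \<inter> {..u}"
    unfolding a_def using assms closed by (intro closed_contains_Sup) auto
  then have a: "a \<in> T" "a < u" using u by (auto simp: less_le)
  obtain v where "v \<in> T" "a < v" "v < u"
  proof -
    have "forward_jump T a < u" using a forward_jump_eq by simp
    then show ?thesis
      using ex_gt[of a] that unfolding forward_jump_def by (subst (asm) cInf_less_iff) auto
  qed
  moreover have "v \<le> a" unfolding a_def using \<open>v \<in> T\<close> \<open>v < u\<close>
    by (intro cSup_upper bdd_aboveI[of _ u]) auto
  ultimately show False by simp
qed

lemma has_delta_derivative_iff:
  assumes t: "t \<in> T"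
  shows "has_delta_derivative T x D t \<longleftrightarrow> (x has_vector_derivative D) (at t within T)"
proof -
  have "norm (x t - x r - D * of_real (t - r)) = norm (x r - x t - (r - t) *\<^sub>R D)" for r
    by (subst norm_minus_commute) (simp add: scaleR_conv_of_real algebra_simps)
  then show ?thesis
    by (auto simp: has_delta_derivative_def forward_jump_eq[OF t] has_vector_derivative_def
        has_derivative_within_alt bounded_linear_scaleR_left abs_minus_commute)
qed

text \<open>Here the equation is \<open>x' = - z x\<close>. For uniqueness, a solution times the
  integrating factor \<open>exp (z * (r - s))\<close> has zero derivative on the convex set
  \<open>{s..}\<close> and is constant there.\<close>

lemma delta_exp_circle_minus:
  assumes s: "s \<in> T" and t: "s \<le> t"
  shows "delta_exp T (circle_minus T (\<lambda>_. z)) t s = exp (- z * of_real (t - s))"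
proof -
  have solution: "has_delta_derivative T x (circle_minus T (\<lambda>_. z) r * x r) r \<longleftrightarrow>
      (x has_vector_derivative - z * x r) (at r within T)" if "r \<in> T" for x r
    using that by (simp add: has_delta_derivative_iff circle_minus_const)
  have deriv: "((\<lambda>r. exp (c * of_real (r - s))) has_vector_derivative c * exp (c * of_real (r - s))) (at r within A)"
    for c :: complex and r A
  proof -
    have "((\<lambda>w. exp (c * (w - of_real s))) has_field_derivative c * exp (c * (of_real r - of_real s)))
        (at (of_real r))"
      by (auto intro!: derivative_eq_intros)
    from has_vector_derivative_real_field[OF this] show ?thesis by simp
  qed
  show ?thesis
    unfolding delta_exp_def
  proof (rule the_equality)
    show "\<exists>x. x s = 1 \<and>
        (\<forall>r\<in>T. has_delta_derivative T x (circle_minus T (\<lambda>_. z) r * x r) r) \<and>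
        x t = exp (- z * of_real (t - s))"
    proof (intro exI[of _ "\<lambda>r. exp (- z * of_real (r - s))"] conjI ballI)
      fix r assume "r \<in> T"
      then show "has_delta_derivative T (\<lambda>r. exp (- z * of_real (r - s)))
          (circle_minus T (\<lambda>_. z) r * exp (- z * of_real (r - s))) r"
        using solution[of r "\<lambda>r. exp (- z * of_real (r - s))"] deriv[of "- z" r T] by simp
    qed simp_all
  next
    fix y
    assume "\<exists>x. x s = 1 \<and>
        (\<forall>r\<in>T. has_delta_derivative T x (circle_minus T (\<lambda>_. z) r * x r) r) \<and> x t = y"
    then obtain x where x: "x s = 1" "x t = y"
        "\<And>r. r \<in> T \<Longrightarrow> (x has_vector_derivative - z * x r) (at r within T)"
      using solution by blast
    have "((\<lambda>r. x r * exp (z * of_real (r - s))) has_vector_derivative 0) (at r within {s..})"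
      if "r \<in> {s..}" for r
    proof -
      have "r \<in> T" "{s..} \<subseteq> T" using upward_closed[OF s] that by auto
      then have "(x has_vector_derivative - z * x r) (at r within {s..})"
        using x(3) has_vector_derivative_within_subset by blast
      from has_vector_derivative_mult[OF this deriv[of z r]] show ?thesis
        by (simp add: algebra_simps)
    qed
    then obtain c where c: "\<And>r. r \<in> {s..} \<Longrightarrow> x r * exp (z * of_real (r - s)) = c"
      using has_vector_derivative_zero_constant[OF convex_real_interval(1)] by blast
    let ?w = "z * of_real (t - s)"
    have "y * exp ?w = 1" using c[of t] c[of s] x t by simp
    moreover have "y = y * exp ?w * exp (- ?w)"
      by (simp only: mult.assoc exp_minus_inverse mult_1_right)
    ultimately show "y = exp (- z * of_real (t - s))" by simp
  qed
qed

text \<open>The uncompleted \<open>\<Delta>\<close>-measure and the restriction of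
  \<open>lborel\<close> agree on an intersection-stable generator of the Borel sets of
  \<open>T\<close>, hence everywhere; completing both gives the claim.\<close>

lemma delta_measure_eq: "delta_measure T = lebesgue_on T"
proof -
  define I where "I = {(a, b). a \<in> T \<and> b \<in> T \<and> a \<le> b}"
  define G where "G = (\<lambda>(a, b). {a..<b} \<inter> T)"
  define M where "M = extend_measure T I G (\<lambda>(a, b). ennreal (b - a))"
  have delta: "delta_measure T = completion M"
    unfolding delta_measure_def M_def I_def G_def ..
  obtain u where u: "u \<in> T" using nonempty by auto
  have T: "T \<in> sets borel" using closed by auto
  have T_cases: "T = UNIV \<or> T = {Inf T..}"
  proof (cases "bdd_below T")
    case True
    then have "Inf T \<in> T" using closed nonempty by (intro closed_contains_Inf)
    then have "T = {Inf T..}" using upward_closed[of "Inf T"] cInf_lower[OF _ True] by auto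
    then show ?thesis ..
  next
    case False
    then have "x \<in> T" for x
      using upward_closed by (meson bdd_below_def linear)
    then show ?thesis by auto
  qed
  \<comment> \<open>Allowing arbitrary real endpoints adds no new traces on \<open>T\<close>. In
    this form stability under intersection and generation of the Borel sets are inherited from
    half-open intervals of the line.\<close>
  have gen: "G ` I = (\<inter>) T ` range (\<lambda>(a, b). {a..<b})"
  proof (intro equalityI subsetI)
    fix A assume "A \<in> (\<inter>) T ` range (\<lambda>(a, b). {a..<b})"
    then obtain a b where A: "A = T \<inter> {a..<b}" by auto
    show "A \<in> G ` I"
    proof (cases "A = {}")
      case True
      then have "A = G (u, u)" "(u, u) \<in> I" using u by (auto simp: G_def I_def)
      then show ?thesis by blast
    next
      case False
      then obtain v where v: "v \<in> T" "a \<le> v" "v < b" using A by auto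
      then have b: "b \<in> T" using upward_closed by auto
      show ?thesis
      proof (cases "a \<in> T")
        case True
        then have "A = G (a, b)" "(a, b) \<in> I" using A b v by (auto simp: G_def I_def)
        then show ?thesis by blast
      next
        case False
        \<comment> \<open>By upward closure an endpoint \<open>a\<close> outside \<open>T\<close>
          lies below all of \<open>T\<close>, so \<open>T\<close> has a minimum, which replaces
          \<open>a\<close>.\<close>
        define c where "c = Inf T"
        have c: "T = {c..}" using False T_cases by (auto simp: c_def)
        then have "A = G (c, b)" "(c, b) \<in> I" using A b v False by (auto simp: G_def I_def)
        then show ?thesis by blast
      qed
    qed
  qed (auto simp: G_def I_def)
  have Pow: "G ` I \<subseteq> Pow T" by (auto simp: G_def)
  have sets_M: "sets M = sigma_sets T (G ` I)"
    unfolding M_def by (rule sets_extend_measure[OF Pow])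
  have "sets (restrict_space lborel T) = (\<inter>) T ` sets borel"
    by (simp add: sets_restrict_space)
  also have "\<dots> = (\<inter>) T ` sigma_sets UNIV (range (\<lambda>(a, b). {a..<b}))"
    by (subst borel_eq_atLeastLessThan) simp
  also have "\<dots> = sigma_sets T (G ` I)"
    unfolding gen
  proof (rule sigma_sets_Int)
    have "sigma_sets UNIV (range (\<lambda>(a, b). {a..<b})) = sets (borel :: real measure)"
      by (subst borel_eq_atLeastLessThan) simp
    with T show "T \<in> sigma_sets UNIV (range (\<lambda>(a, b). {a..<b}))" by simp
  qed simp
  finally have sets_N: "sets (restrict_space lborel T) = sigma_sets T (G ` I)" .
  \<comment> \<open>\<open>extend_measure\<close> takes the prescribed values because an extension
    exists, which is the content of \<open>emeasure_delta_measure_Ico\<close>.\<close>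
  have emeasure_M: "emeasure M (G (a, b)) = ennreal (b - a)" if "(a, b) \<in> I" for a b
  proof -
    have "G (a, b) \<in> sets M" using that unfolding sets_M by (intro sigma_sets.Basic) blast
    then show ?thesis
      using emeasure_delta_measure_Ico(2)[OF time_scale, of a b] that
      by (simp add: delta I_def G_def)
  qed
  have "M = restrict_space lborel T"
  proof (rule measure_eqI_generator_eq[OF _ Pow _ sets_M sets_N])
    show "Int_stable (G ` I)"
      unfolding gen
    proof (rule Int_stableI_image, safe)
      fix a b c d :: real
      have "T \<inter> {a..<b} \<inter> (T \<inter> {c..<d}) = T \<inter> {max a c..<min b d}" by auto
      moreover have "{max a c..<min b d} \<in> range (\<lambda>(a, b). {a..<b})"
        by (rule range_eqI[of _ _ "(max a c, min b d)"]) simp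
      ultimately show "\<exists>k\<in>range (\<lambda>(a, b). {a..<b}). T \<inter> {a..<b} \<inter> (T \<inter> {c..<d}) = T \<inter> k"
        by (rule bexI)
    qed
    fix X assume "X \<in> G ` I"
    then obtain a b where X: "X = G (a, b)" "(a, b) \<in> I" by auto
    have "G (a, b) = {a..<b}" using upward_closed X by (auto simp: G_def I_def)
    then have "emeasure (restrict_space lborel T) X = emeasure lborel {a..<b}"
      using X T by (subst emeasure_restrict_space) (auto simp: G_def)
    then show "emeasure M X = emeasure (restrict_space lborel T) X"
      using X emeasure_M by (simp add: I_def)
  next
    \<comment> \<open>An exhaustion of \<open>T\<close> by generators of finite measure, as
      uniqueness of the extension requires.\<close>
    define A where "A n = T \<inter> {- real n..<real n}" for n
    show "range A \<subseteq> G ` I" unfolding gen A_def by auto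
    show "(\<Union>n. A n) = T"
    proof (intro equalityI subsetI)
      fix x assume "x \<in> T"
      obtain n where "\<bar>x\<bar> < real n" using reals_Archimedean2 by blast
      then show "x \<in> (\<Union>n. A n)" using \<open>x \<in> T\<close> by (auto simp: A_def intro!: exI[of _ n])
    qed (auto simp: A_def)
    fix n
    have "A n \<in> G ` I" unfolding gen A_def by auto
    then show "emeasure M (A n) \<noteq> \<infinity>" using emeasure_M by auto
  qed
  then show ?thesis
    unfolding delta using T by (simp add: completion_restrict_space)
qed

lemma delta_integral_eq:
  assumes "s \<in> T" and F: "F absolutely_integrable_on {s..t}"
  shows "delta_integral T s t F = integral {s..t} F"
proof -
  have sub: "{s..<t} \<inter> T = {s..<t}" "{s..<t} \<subseteq> T" using upward_closed[OF \<open>s \<in> T\<close>] by auto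
  have "T \<inter> space lebesgue \<in> sets lebesgue" using closed by auto
  then have "delta_integral T s t F = (LINT x:{s..<t}|lebesgue. F x)"
    unfolding delta_integral_def delta_measure_eq set_lebesgue_integral_def sub(1)
    using sub by (subst integral_restrict_space)
      (auto simp: indicator_def intro!: Bochner_Integration.integral_cong)
  \<comment> \<open>The two intervals differ at most by the Lebesgue null set
    \<open>{t}\<close>.\<close>
  also have "\<dots> = (LINT x:{s..t}|lebesgue. F x)"
    by (rule set_integral_discrete_difference[where X = "{t}"]) auto
  also have "\<dots> = integral {s..t} F"
    using F by (rule set_lebesgue_integral_eq_integral)
  finally show ?thesis .
qed

lemma locally_delta_integrableD:
  assumes s: "s \<in> T" and f: "locally_delta_integrable T s f"
  shows "f absolutely_integrable_on {s..t}"
proof (cases "s \<le> t")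
  case True
  have sub: "{s..t} \<inter> T = {s..t}" "{s..t} \<subseteq> T" using upward_closed[OF s] by auto
  have meas: "T \<inter> space lebesgue \<in> sets lebesgue" using closed by auto
  have "set_integrable (lebesgue_on T) ({s..t} \<inter> T) f"
    using f s True upward_closed[OF s] unfolding locally_delta_integrable_def delta_measure_eq by auto
  moreover have "(\<lambda>x. indicator T x *\<^sub>R (indicator {s..t} x *\<^sub>R f x)) = (\<lambda>x. indicator {s..t} x *\<^sub>R f x)"
    using sub(2) by (auto simp: indicator_def fun_eq_iff)
  ultimately show ?thesis
    unfolding set_integrable_def sub(1) integrable_restrict_space[OF meas] by simp
qed (simp add: set_integrable_def)

lemma null_function_if_laplace_eq_0:
  assumes s: "s \<in> T" and f: "locally_delta_integrable T s f"
    and lap: "\<And>z. z \<in> hilger_half_plane 0 \<alpha> \<Longrightarrow> laplace_exists T s f z \<and> laplace T s f z = 0"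
  shows "null_function T s f"
proof -
  note f = locally_delta_integrableD[OF s f]
  \<comment> \<open>Clamping at \<open>s\<close> keeps the argument in \<open>T\<close>, so limits
    along \<open>T\<close> become ordinary limits at infinity.\<close>
  have at_top: "filterlim (\<lambda>t. max s t) (at_top_within T) at_top"
    unfolding at_top_within_def using upward_closed[OF s]
    by (auto simp: filterlim_inf filterlim_principal intro!: filterlim_at_top_mono[OF filterlim_ident])
  have "((\<lambda>t. integral {s..t} (\<lambda>x. f x * of_real (exp (- (c * (x - s)))))) \<longlongrightarrow> 0) at_top"
    if "c > \<alpha>" for c
  proof -
    let ?F = "\<lambda>x. f x * of_real (exp (- (c * (x - s))))"
    have "of_real c \<in> hilger_half_plane 0 \<alpha>"
      using that by (simp add: hilger_half_plane_def hilger_plane_def hilger_Re_def)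
    from laplace_tendsto[of s f "of_real c"] lap[OF this]
    have "((\<lambda>t. delta_integral T s t (laplace_integrand T s f (of_real c))) \<longlongrightarrow> 0) (at_top_within T)"
      by simp
    then have "((\<lambda>t. delta_integral T s (max s t) (laplace_integrand T s f (of_real c))) \<longlongrightarrow> 0) at_top"
      by (rule filterlim_compose[OF _ at_top])
    moreover have "delta_integral T s t (laplace_integrand T s f (of_real c)) = integral {s..t} ?F" for t
    proof -
      \<comment> \<open>The forward jump is the identity here, and the exponential is known for
        \<open>x \<ge> s\<close>, which is all that the integral sees.\<close>
      have "laplace_integrand T s f (of_real c) x = ?F x" if "x \<in> {s..<t} \<inter> T" for x
      proof -
        have "delta_exp T (circle_minus T (\<lambda>_. of_real c)) x s = of_real (exp (- c * (x - s)))"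
          using that delta_exp_circle_minus[OF s, of x "of_real c"]
          by (simp only: flip: of_real_minus of_real_mult exp_of_real) simp
        then show ?thesis
          using that forward_jump_eq[of x] by (simp add: laplace_integrand_def)
      qed
      then have "delta_integral T s t (laplace_integrand T s f (of_real c)) = delta_integral T s t ?F"
        unfolding delta_integral_def set_lebesgue_integral_def
        by (intro Bochner_Integration.integral_cong) (auto simp: indicator_def)
      also have "\<dots> = integral {s..t} ?F"
        by (intro delta_integral_eq s absolutely_integrable_mult_continuous f continuous_intros)
      finally show ?thesis .
    qed
    moreover have "\<forall>\<^sub>F t in at_top. max s t = t"
      using eventually_ge_at_top[of s] by eventually_elim simp
    ultimately show ?thesis
      by (auto elim!: Lim_transform_eventually eventually_mono)
  qed
  then have "integral {s..t} f = 0" if "t \<ge> s" for t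
    using laplace_eq_0_imp_integral_eq_0[OF f] that by blast
  then show ?thesis
    by (simp add: null_function_def delta_integral_eq[OF s f])
qed

end

section \<open>The theorem, by cases on the constant graininess\<close>

theorem corollary6:
  fixes T :: "real set" and s \<alpha> :: real and f :: "real \<Rightarrow> complex"
  assumes "time_scale T"
    and "\<not> bdd_above T"
    and "graininess T constant_on T"
    and "s \<in> T"
    and "locally_delta_integrable T s f"
    and "\<And>t. t \<in> {s..} \<inter> T \<Longrightarrow> 1 + \<alpha> * graininess T t > 0"
    and "\<And>z. z \<in> hilger_half_plane (min_graininess T s) \<alpha> \<Longrightarrow>
           laplace_exists T s f z \<and> laplace T s f z = 0"
  shows "null_function T s f"
proof -
  obtain h where h: "\<And>t. t \<in> T \<Longrightarrow> graininess T t = h"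
    using assms(3) by (auto simp: constant_on_def)
  interpret constant_graininess T h
    using assms(1,2) h by unfold_locales
  have "h \<ge> 0" using forward_jump_ge[of s] forward_jump_eq[OF \<open>s \<in> T\<close>] by simp
  have lap: "laplace_exists T s f z \<and> laplace T s f z = 0" if "z \<in> hilger_half_plane h \<alpha>" for z
    using assms(7) that min_graininess_eq[OF \<open>s \<in> T\<close>] by simp
  show ?thesis
  proof (cases "h = 0")
    case True
    interpret continuous_time_scale T
      by unfold_locales (use h True in auto)
    show ?thesis
      using null_function_if_laplace_eq_0[OF assms(4,5)] lap True by blast
  next
    case False
    interpret discrete_time_scale T h
      by unfold_locales (use \<open>h \<ge> 0\<close> False in auto)
    show ?thesis
      using null_function_if_laplace_eq_0[OF \<open>s \<in> T\<close> _ lap] assms(6)[of s] h \<open>s \<in> T\<close> by simp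
  qed
qed

end
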